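(* For each $1\leq p <\infty$, the following decomposition into complemented subspaces holds: $L^{p}(\mu)=G^{p}\oplus B^{p}\cong \ell^{p}(\mathfrak c,L^{p}[0,1])\oplus B^{p}$.
   Context: Let $\mathcal{B}$ be the Borel $\sigma$-algebra of $\mathbb{R}$, $\lambda$ the Lebesgue measure, and $\mathcal{B}_{\infty}$ the $\sigma$-algebra on $\mathbb{R}^{\mathbb{N}}$ generated by the cylinder sets $\prod_{i=1}^{m}C_{i}\times\prod_{i=m+1}^{\infty}\mathbb{R}$ with $C_i\in\mathcal{B}$, $m\in\mathbb{N}$. Let $\mathcal{F}(\mathcal{B},\lambda)$ be the set of finite rectangles $\prod_{i\in\mathbb{N}}C_{i}$ with $C_i\in\mathcal{B}$ and $\prod_{i}\lambda(C_i)\in[0,\infty)$, with $\mathrm{vol}(\prod_{i}C_i):=\prod_i\lambda(C_i)$. The measure $\mu$ is the restriction to $\mathcal{B}_{\infty}$ of the outer measure $\mu^{\ast}(A):=\inf\{\sum_{n}\mathrm{vol}(\mathscr{C}_{n}) : \mathscr{C}_{n}\in\mathcal{F}(\mathcal{B},\lambda),\ A\subset\bigcup_{n}\mathscr{C}_{n}\}$ ($\inf\varnothing=\infty$). Let $I:=\mathbb{Z}^{\mathbb{N}}$ and, for $\mathfrak{a}=(a_n)\in I$, $\mathcal{C}_{\mathfrak{a}}:=\prod_{n\in\mathbb{N}}[a_{n},a_{n}+1)$. For $f\in L^p(\mu)$ let $\mathcal{O}_{f}:=\{\mathfrak{a}\in I : \int_{\mathcal{C}_{\mathfrak{a}}}|f|^{p}\,d\mu\neq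 0\}$ and $\mathcal{F}_{f}:=\bigsqcup_{\mathfrak{a}\in\mathcal{O}_{f}}\mathcal{C}_{\mathfrak{a}}$. Define $G^{p}:=\{f\in L^{p}(\mu) : \int_{\mathbb{R}^{\mathbb{N}}}|f|^{p}\,d\mu=\sum_{\mathfrak{a}\in\mathcal{O}_{f}}\int_{\mathcal{C}_{\mathfrak{a}}}|f|^{p}\,d\mu=\int_{\mathcal{F}_{f}}|f|^{p}\,d\mu\}$ and $B^{p}:=\{f\in L^{p}(\mu) : \int_{\mathcal{C}_{\mathfrak{a}}}|f|^{p}\,d\mu=0 \text{ for each } \mathfrak{a}\in I\}$, both closed subspaces of $L^p(\mu)$. $\ell^{p}(\kappa,X)$ denotes the $\ell^p$-sum of $\kappa$ copies of the Banach space $X$, and $\mathfrak{c}$ is the cardinality of the continuum. *)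

theory Defs
  imports "HOL-Analysis.Analysis"
begin

definition cylinders :: "(nat \<Rightarrow> real) set set" where
  "cylinders = {{x. \<forall>i<m. x i \<in> C i} | m C. \<forall>i<m. C i \<in> sets borel}"

definition Binf :: "(nat \<Rightarrow> real) set set" where
  "Binf = sigma_sets UNIV cylinders"

definition rect :: "(nat \<Rightarrow> real set) \<Rightarrow> (nat \<Rightarrow> real) set" where
  "rect C = {x. \<forall>i. x i \<in> C i}"

definition rect_vol :: "(nat \<Rightarrow> real set) \<Rightarrow> ennreal" where
  "rect_vol C = lim (\<lambda>n. \<Prod>i<n. emeasure lborel (C i))"

definition finite_rect :: "(nat \<Rightarrow> real set) \<Rightarrow> bool" where
  "finite_rect C \<longleftrightarrow> (\<forall>i. C i \<in> sets borel) \<and>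
     (\<exists>L. ((\<lambda>n. \<Prod>i<n. emeasure lborel (C i)) \<longlonglongrightarrow> L) \<and> L < \<infinity>)"

text \<open>Outer measure (Inf of the empty set is \<infinity> = top).\<close>
definition outer_mu :: "(nat \<Rightarrow> real) set \<Rightarrow> ennreal" where
  "outer_mu A = Inf {(\<Sum>n. rect_vol (C n)) | C :: nat \<Rightarrow> nat \<Rightarrow> real set.
                       (\<forall>n. finite_rect (C n)) \<and> A \<subseteq> (\<Union>n. rect (C n))}"

definition mu :: "(nat \<Rightarrow> real) measure" where
  "mu = measure_of UNIV cylinders outer_mu"

section \<open>L^p spaces (as sets of representatives) and seminorms\<close>

definition Lp :: "real \<Rightarrow> 'a measure \<Rightarrow> ('a \<Rightarrow> real) set" where
  "Lp p M = {f. f \<in> borel_measurable M \<and> integrable M (\<lambda>x. \<bar>f x\<bar> powr p)}"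

definition lpnorm :: "real \<Rightarrow> 'a measure \<Rightarrow> ('a \<Rightarrow> real) \<Rightarrow> real" where
  "lpnorm p M f = (\<integral>x. \<bar>f x\<bar> powr p \<partial>M) powr (1 / p)"

definition cube :: "(nat \<Rightarrow> int) \<Rightarrow> (nat \<Rightarrow> real) set" where
  "cube a = {x. \<forall>n. of_int (a n) \<le> x n \<and> x n < of_int (a n) + 1}"

definition Ofun :: "real \<Rightarrow> ((nat \<Rightarrow> real) \<Rightarrow> real) \<Rightarrow> (nat \<Rightarrow> int) set" where
  "Ofun p f = {a. (\<integral>\<^sup>+ x. indicator (cube a) x * ennreal (\<bar>f x\<bar> powr p) \<partial>mu) \<noteq> 0}"

definition Ffun :: "real \<Rightarrow> ((nat \<Rightarrow> real) \<Rightarrow> real) \<Rightarrow> (nat \<Rightarrow> real) set" where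
  "Ffun p f = (\<Union>a\<in>Ofun p f. cube a)"

definition Gp :: "real \<Rightarrow> ((nat \<Rightarrow> real) \<Rightarrow> real) set" where
  "Gp p = {f \<in> Lp p mu.
     (\<integral>\<^sup>+ x. ennreal (\<bar>f x\<bar> powr p) \<partial>mu)
       = (\<Sum>\<^sub>\<infinity> a\<in>Ofun p f. \<integral>\<^sup>+ x. indicator (cube a) x * ennreal (\<bar>f x\<bar> powr p) \<partial>mu)
   \<and> (\<Sum>\<^sub>\<infinity> a\<in>Ofun p f. \<integral>\<^sup>+ x. indicator (cube a) x * ennreal (\<bar>f x\<bar> powr p) \<partial>mu)
       = (\<integral>\<^sup>+ x. indicator (Ffun p f) x * ennreal (\<bar>f x\<bar> powr p) \<partial>mu)}"

definition Bp :: "real \<Rightarrow> ((nat \<Rightarrow> real) \<Rightarrow> real) set" where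
  "Bp p = {f \<in> Lp p mu. \<forall>a. (\<integral>\<^sup>+ x. indicator (cube a) x * ennreal (\<bar>f x\<bar> powr p) \<partial>mu) = 0}"

section \<open>l^p(c, L^p[0,1]), indexed by the reals (cardinality c)\<close>

definition I01 :: "real measure" where
  "I01 = restrict_space lborel {0..1}"

definition lp_sum :: "real \<Rightarrow> (real \<Rightarrow> real \<Rightarrow> real) set" where
  "lp_sum p = {h. (\<forall>i. h i \<in> Lp p I01) \<and>
                  (\<Sum>\<^sub>\<infinity> i\<in>(UNIV::real set). ennreal (lpnorm p I01 (h i) powr p)) < \<infinity>}"

definition lp_sum_norm :: "real \<Rightarrow> (real \<Rightarrow> real \<Rightarrow> real) \<Rightarrow> real" where
  "lp_sum_norm p h =
     enn2real (\<Sum>\<^sub>\<infinity> i\<in>(UNIV::real set). ennreal (lpnorm p I01 (h i) powr p)) powr (1 / p)"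

end

theory Submission
  imports Defs "HOL-Probability.Probability"
begin

text \<open>
  Splitting one factor of a finite rectangle splits its volume, so cylinders are Caratheodory
  measurable for the outer measure and \<open>\<mu>\<close> is a measure. Restricted to a unit cube, \<open>\<mu>\<close> is the
  infinite product of Lebesgue measures. Distributing the binary digits of \<open>t \<in> [0,1]\<close> over
  countably many rows gives a measure preserving map from \<open>[0,1]\<close> onto almost all of the cube with
  an almost everywhere inverse, so \<open>L^p\<close> of each cube is isometric to \<open>L^p[0,1]\<close>. An integrable
  function charges only countably many of the pairwise disjoint cubes. Its restriction to their union
  is its component in \<open>G^p\<close>, the rest lies in \<open>B^p\<close>, and the \<open>G^p\<close>-norm is the \<open>\<ell>^p\<close>-sum of the
  norms over the cubes, which are indexed by a set of cardinality continuum.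
\<close>

section \<open>The measure on sequences\<close>

lemma rect_vol_eqI:
  assumes "(\<lambda>n. \<Prod>i<n. emeasure lborel (C i)) \<longlonglongrightarrow> L"
  shows "rect_vol C = L"
  unfolding rect_vol_def using assms by (rule limI)

lemma finite_rect_tendsto:
  assumes "finite_rect C"
  shows "(\<lambda>n. \<Prod>i<n. emeasure lborel (C i)) \<longlonglongrightarrow> rect_vol C" "rect_vol C < \<infinity>"
  using assms unfolding finite_rect_def by (auto dest: rect_vol_eqI)

lemma finite_rectI:
  assumes "\<And>i. C i \<in> sets borel" "(\<lambda>n. \<Prod>i<n. emeasure lborel (C i)) \<longlonglongrightarrow> L" "L < \<infinity>"
  shows "finite_rect C" "rect_vol C = L"
  using assms rect_vol_eqI[OF assms(2)] unfolding finite_rect_def by auto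

lemma prod_tendsto_zero:
  fixes m :: "nat \<Rightarrow> ennreal"
  assumes "m j = 0"
  shows "(\<lambda>n. \<Prod>i<n. m i) \<longlonglongrightarrow> 0"
proof (rule tendsto_eventually)
  have "\<And>n. j < n \<Longrightarrow> (\<Prod>i<n. m i) = 0"
    using assms by (intro prod_zero) auto
  then show "eventually (\<lambda>n. (\<Prod>i<n. m i) = 0) sequentially"
    by (intro eventually_mono[OF eventually_gt_at_top[of j]])
qed

lemma finite_rect_factor_finite:
  assumes C: "finite_rect C" and nz: "\<And>j. emeasure lborel (C j) \<noteq> 0"
  shows "emeasure lborel (C k) \<noteq> top"
proof
  assume top: "emeasure lborel (C k) = top"
  have "(\<Prod>i<n. emeasure lborel (C i)) = top" if "k < n" for n
  proof -
    have "(\<Prod>i<n. emeasure lborel (C i))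
        = emeasure lborel (C k) * (\<Prod>i\<in>{..<n} - {k}. emeasure lborel (C i))"
      using that by (intro prod.remove) auto
    then show ?thesis
      using top nz by (simp add: ennreal_top_mult)
  qed
  then have "eventually (\<lambda>n. (\<Prod>i<n. emeasure lborel (C i)) = top) sequentially"
    by (intro eventually_mono[OF eventually_gt_at_top[of k]])
  then have "(\<lambda>n. \<Prod>i<n. emeasure lborel (C i)) \<longlonglongrightarrow> top"
    by (rule tendsto_eventually)
  with finite_rect_tendsto[OF C] show False
    using LIMSEQ_unique by fastforce
qed

lemma finite_rect_shrink:
  assumes C: "finite_rect C" and E: "E \<in> sets borel"
    and nz: "\<And>j. emeasure lborel (C j) \<noteq> 0"
    and le: "emeasure lborel E \<le> emeasure lborel (C k)"
  shows "(\<lambda>n. \<Prod>i<n. emeasure lborel ((C(k := E)) i))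
    \<longlonglongrightarrow> emeasure lborel E / emeasure lborel (C k) * rect_vol C"
proof -
  let ?c = "emeasure lborel E / emeasure lborel (C k)"
  have fin: "emeasure lborel (C k) \<noteq> top"
    using C nz by (rule finite_rect_factor_finite)
  have "?c < top"
    using fin nz[of k] le by (auto simp: ennreal_divide_eq_top_iff less_top[symmetric] top_unique)
  then have "(\<lambda>n. ?c * (\<Prod>i<n. emeasure lborel (C i))) \<longlonglongrightarrow> ?c * rect_vol C"
    using finite_rect_tendsto(1)[OF C] by (intro ennreal_tendsto_cmult) auto
  moreover have "?c * (\<Prod>i<n. emeasure lborel (C i)) = (\<Prod>i<n. emeasure lborel ((C(k := E)) i))"
    if "k < n" for n
  proof -
    have *: "(\<Prod>i<n. emeasure lborel (C' i))
        = emeasure lborel (C' k) * (\<Prod>i\<in>{..<n} - {k}. emeasure lborel (C' i))"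
      for C' :: "nat \<Rightarrow> real set"
      using that by (intro prod.remove) auto
    have "(\<Prod>i\<in>{..<n} - {k}. emeasure lborel ((C(k := E)) i))
        = (\<Prod>i\<in>{..<n} - {k}. emeasure lborel (C i))"
      by (intro prod.cong) auto
    moreover have "emeasure lborel (C k) / emeasure lborel (C k) = 1"
      using fin nz[of k] by (intro ennreal_divide_self) (auto simp: less_top)
    ultimately show ?thesis
      by (simp add: * mult.assoc[symmetric] ennreal_divide_times ennreal_times_divide[symmetric])
  qed
  ultimately show ?thesis
    by (elim Lim_transform_eventually)
       (auto intro!: eventually_mono[OF eventually_gt_at_top[of k]])
qed

lemma finite_rect_split:
  assumes C: "finite_rect C" and D: "D \<in> sets borel"
  shows "finite_rect (C(k := C k \<inter> D))" "finite_rect (C(k := C k - D))"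
    "rect_vol (C(k := C k \<inter> D)) + rect_vol (C(k := C k - D)) = rect_vol C"
proof -
  have Cb: "\<And>i. C i \<in> sets borel"
    using C by (auto simp: finite_rect_def)
  have le: "emeasure lborel (C k \<inter> D) \<le> emeasure lborel (C k)"
    "emeasure lborel (C k - D) \<le> emeasure lborel (C k)"
    using Cb D by (auto intro!: emeasure_mono)
  have add: "emeasure lborel (C k \<inter> D) + emeasure lborel (C k - D) = emeasure lborel (C k)"
    using Cb[of k] D by (subst plus_emeasure) (auto intro!: arg_cong2[where f=emeasure])
  have "finite_rect (C(k := C k \<inter> D)) \<and> finite_rect (C(k := C k - D)) \<and>
    rect_vol (C(k := C k \<inter> D)) + rect_vol (C(k := C k - D)) = rect_vol C"
  proof (cases "\<exists>j. emeasure lborel (C j) = 0")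
    case True
    then obtain j where j: "emeasure lborel (C j) = 0" by auto
    have z: "(\<lambda>n. \<Prod>i<n. emeasure lborel ((C(k := E)) i)) \<longlonglongrightarrow> 0"
      if "emeasure lborel E \<le> emeasure lborel (C k)" for E
      using that j by (intro prod_tendsto_zero[of _ j]) auto
    have "rect_vol C = 0"
      by (intro rect_vol_eqI prod_tendsto_zero[of _ j] j)
    moreover have "finite_rect (C(k := E)) \<and> rect_vol (C(k := E)) = 0"
      if "E \<in> sets borel" "emeasure lborel E \<le> emeasure lborel (C k)" for E
      using that(1) Cb finite_rectI[OF _ z[OF that(2)]] by (simp del: fun_upd_apply) (auto simp: fun_upd_def)
    ultimately show ?thesis
      using le Cb D by simp
  next
    case False
    then have nz: "\<And>j. emeasure lborel (C j) \<noteq> 0" by auto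
    have fin: "emeasure lborel (C k) \<noteq> top"
      using C nz by (rule finite_rect_factor_finite)
    have R: "finite_rect (C(k := E))
        \<and> rect_vol (C(k := E)) = emeasure lborel E / emeasure lborel (C k) * rect_vol C"
      if E: "E \<in> sets borel" "emeasure lborel E \<le> emeasure lborel (C k)" for E
    proof -
      have "emeasure lborel E / emeasure lborel (C k) * rect_vol C < \<infinity>"
        using fin nz[of k] E(2) finite_rect_tendsto(2)[OF C]
        by (auto simp: ennreal_divide_eq_top_iff less_top[symmetric] top_unique ennreal_mult_eq_top_iff)
      then show ?thesis
        using finite_rectI[OF _ finite_rect_shrink[OF C E(1) nz E(2)]] E(1) Cb by (simp del: fun_upd_apply) (auto simp: fun_upd_def)
    qed
    have "emeasure lborel (C k \<inter> D) / emeasure lborel (C k) * rect_vol C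
        + emeasure lborel (C k - D) / emeasure lborel (C k) * rect_vol C = rect_vol C"
      using fin nz[of k]
      by (simp add: distrib_right[symmetric] add_divide_distrib_ennreal[symmetric] add ennreal_divide_self less_top[symmetric])
    then show ?thesis
      using R[of "C k \<inter> D"] R[of "C k - D"] le Cb D by simp
  qed
  then show "finite_rect (C(k := C k \<inter> D))" "finite_rect (C(k := C k - D))"
    "rect_vol (C(k := C k \<inter> D)) + rect_vol (C(k := C k - D)) = rect_vol C"
    by auto
qed

lemma outer_mu_le:
  assumes "\<And>n. finite_rect (C n)" "A \<subseteq> (\<Union>n. rect (C n))"
  shows "outer_mu A \<le> (\<Sum>n. rect_vol (C n))"
  unfolding outer_mu_def using assms by (intro Inf_lower) auto

lemma outer_mu_greatest:
  assumes "\<And>C. (\<And>n. finite_rect (C n)) \<Longrightarrow> A \<subseteq> (\<Union>n. rect (C n)) \<Longrightarrow> x \<le> (\<Sum>n. rect_vol (C n))"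
  shows "x \<le> outer_mu A"
  unfolding outer_mu_def using assms by (intro Inf_greatest) auto

lemma outer_mu_close:
  assumes "outer_mu A < e"
  obtains C where "\<And>n. finite_rect (C n)" "A \<subseteq> (\<Union>n. rect (C n))" "(\<Sum>n. rect_vol (C n)) < e"
  using assms unfolding outer_mu_def Inf_less_iff by blast

lemma finite_rect_empty: "finite_rect (\<lambda>_. {})" "rect_vol (\<lambda>_. {}) = 0"
proof -
  have "(\<lambda>n. \<Prod>i<n. emeasure lborel ({}::real set)) \<longlonglongrightarrow> 0"
    by (rule prod_tendsto_zero[of _ 0]) simp
  then show "finite_rect (\<lambda>_. {})" "rect_vol (\<lambda>_. {}) = 0"
    by (intro finite_rectI[where L=0]; simp)+
qed

lemma outer_mu_rect_le:
  assumes "finite_rect C"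
  shows "outer_mu (rect C) \<le> rect_vol C"
proof -
  have "outer_mu (rect C) \<le> (\<Sum>n. rect_vol (if n = 0 then C else (\<lambda>_. {})))"
    using assms finite_rect_empty by (intro outer_mu_le) (auto split: if_splits)
  also have "\<dots> = rect_vol C"
    using finite_rect_empty by (subst suminf_finite[of "{0}"]) auto
  finally show ?thesis .
qed

lemma outer_mu_mono: "A \<subseteq> B \<Longrightarrow> outer_mu A \<le> outer_mu B"
  by (rule outer_mu_greatest) (auto intro!: outer_mu_le)

lemma outer_mu_empty: "outer_mu {} = 0"
  using outer_mu_rect_le[OF finite_rect_empty(1)] finite_rect_empty(2)
  by (simp add: rect_def)

lemma outer_mu_countably_subadditive: "outer_mu (\<Union>i. A i) \<le> (\<Sum>i. outer_mu (A i))"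
proof (rule ennreal_le_epsilon)
  fix e :: real
  assume "0 < e" "(\<Sum>n. outer_mu (A n)) < top"
  then have *: "\<And>n. outer_mu (A n) < outer_mu (A n) + e * (1/2)^Suc n"
    by (auto simp add: less_top dest!: ennreal_suminf_lessD)
  have "\<exists>B. (\<forall>i. finite_rect (B i)) \<and> A n \<subseteq> (\<Union>i. rect (B i))
      \<and> (\<Sum>i. rect_vol (B i)) \<le> outer_mu (A n) + e * (1/2)^(Suc n)" for n
    using outer_mu_close[OF *[of n]] by (metis less_imp_le)
  then obtain B where B: "\<And>n i. finite_rect (B n i)" "\<And>n. A n \<subseteq> (\<Union>i. rect (B n i))"
    and le: "\<And>n. (\<Sum>i. rect_vol (B n i)) \<le> outer_mu (A n) + e * (1/2)^(Suc n)"
    by metis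
  define C where "C = case_prod B o prod_decode"
  have "(\<Union>i. A i) \<subseteq> (\<Union>i. rect (C i))"
    using B(2) by (auto simp add: C_def subset_eq) (metis prod.case prod_encode_inverse)
  then have "outer_mu (\<Union>i. A i) \<le> (\<Sum>i. rect_vol (C i))"
    using B(1) by (intro outer_mu_le) (auto simp: C_def split_def)
  also have "\<dots> = (\<Sum>n. \<Sum>i. rect_vol (B n i))"
    unfolding C_def comp_def
    by (subst suminf_ennreal_2dimen[of _ "\<lambda>x. rect_vol (case x of (x, y) \<Rightarrow> B x y)"]) auto
  also have "\<dots> \<le> (\<Sum>n. outer_mu (A n) + e * (1/2) ^ Suc n)"
    by (intro suminf_le allI le) auto
  also have "\<dots> = (\<Sum>n. outer_mu (A n)) + (\<Sum>n. ennreal e * ennreal ((1/2) ^ Suc n))"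
    using \<open>0 < e\<close> by (subst suminf_add[symmetric])
                     (auto simp del: ennreal_suminf_cmult simp add: ennreal_mult[symmetric])
  also have "\<dots> = (\<Sum>n. outer_mu (A n)) + e"
    unfolding ennreal_suminf_cmult
    by (subst suminf_ennreal_eq[OF zero_le_power power_half_series]) auto
  finally show "outer_mu (\<Union>i. A i) \<le> (\<Sum>n. outer_mu (A n)) + e" .
qed

lemma outer_measure_space_outer_mu: "outer_measure_space UNIV outer_mu"
  unfolding outer_measure_space_def positive_def increasing_def countably_subadditive_def
  using outer_mu_empty outer_mu_mono outer_mu_countably_subadditive by auto

lemma outer_mu_split:
  assumes D: "D \<in> sets borel"
  shows "outer_mu (X \<inter> {x. x k \<in> D}) + outer_mu (X - {x. x k \<in> D}) = outer_mu X"
proof (rule antisym)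
  show "outer_mu (X \<inter> {x. x k \<in> D}) + outer_mu (X - {x. x k \<in> D}) \<le> outer_mu X"
  proof (rule outer_mu_greatest)
    fix C :: "nat \<Rightarrow> nat \<Rightarrow> real set"
    assume C: "\<And>n. finite_rect (C n)" "X \<subseteq> (\<Union>n. rect (C n))"
    note sp = finite_rect_split[OF C(1) D, of _ k]
    have r: "rect (c(k := c k \<inter> D)) = rect c \<inter> {x. x k \<in> D}" "rect (c(k := c k - D)) = rect c - {x. x k \<in> D}" for c
      by (auto simp: rect_def fun_upd_def split: if_splits)
    have "outer_mu (X \<inter> {x. x k \<in> D}) \<le> (\<Sum>n. rect_vol ((C n)(k := C n k \<inter> D)))"
      using C(2) sp by (intro outer_mu_le) (auto simp: r)
    moreover have "outer_mu (X - {x. x k \<in> D}) \<le> (\<Sum>n. rect_vol ((C n)(k := C n k - D)))"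
      using C(2) sp by (intro outer_mu_le) (auto simp: r)
    ultimately have "outer_mu (X \<inter> {x. x k \<in> D}) + outer_mu (X - {x. x k \<in> D})
      \<le> (\<Sum>n. rect_vol ((C n)(k := C n k \<inter> D))) + (\<Sum>n. rect_vol ((C n)(k := C n k - D)))"
      by (rule add_mono)
    also have "\<dots> = (\<Sum>n. rect_vol (C n))"
      using sp by (subst suminf_add) auto
    finally show "outer_mu (X \<inter> {x. x k \<in> D}) + outer_mu (X - {x. x k \<in> D})
      \<le> (\<Sum>n. rect_vol (C n))" .
  qed
  have "subadditive UNIV outer_mu"
    using outer_measure_space_outer_mu sigma_algebra_Pow[of UNIV, simplified]
    by (metis algebra.axioms(1) ring_of_sets.countably_subadditive_subadditive outer_measure_space_def
        sigma_algebra.axioms(1))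
  then have "outer_mu ((X \<inter> {x. x k \<in> D}) \<union> (X - {x. x k \<in> D}))
      \<le> outer_mu (X \<inter> {x. x k \<in> D}) + outer_mu (X - {x. x k \<in> D})"
    by (rule subadditiveD) auto
  then show "outer_mu X \<le> outer_mu (X \<inter> {x. x k \<in> D}) + outer_mu (X - {x. x k \<in> D})"
    by (simp add: Int_Diff_Un)
qed

lemma measure_space_outer_mu: "measure_space UNIV (sigma_sets UNIV cylinders) outer_mu"
proof -
  interpret U: sigma_algebra UNIV "UNIV :: (nat \<Rightarrow> real) set set"
    using sigma_algebra_Pow[of UNIV] by simp
  let ?L = "lambda_system UNIV UNIV outer_mu"
  have ms: "measure_space UNIV ?L outer_mu"
    by (rule U.caratheodory_lemma[OF outer_measure_space_outer_mu])
  then interpret L: sigma_algebra UNIV ?L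
    by (simp add: measure_space_def)
  have one: "{x. x k \<in> D} \<in> ?L" if "D \<in> sets borel" for k D
    unfolding U.lambda_system_eq using outer_mu_split[OF that] by simp
  have "{x. \<forall>i<m. x i \<in> C i} \<in> ?L" if C: "\<forall>i<m. C i \<in> sets borel" for m C
    using C
  proof (induction m)
    case 0 then show ?case using L.top by simp
  next
    case (Suc m)
    have "{x. \<forall>i<Suc m. x i \<in> C i} = {x. \<forall>i<m. x i \<in> C i} \<inter> {x. x m \<in> C m}"
      by (auto simp: less_Suc_eq)
    with Suc one show ?case by auto
  qed
  then have "sigma_sets UNIV cylinders \<subseteq> ?L"
    by (intro L.sigma_sets_subset) (auto simp: cylinders_def)
  then show ?thesis
    by (intro measure_down[OF ms] sigma_algebra_sigma_sets) auto
qed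

lemma space_mu [simp]: "space mu = UNIV"
  by (simp add: mu_def)

lemma sets_mu: "sets mu = sigma_sets UNIV cylinders"
  by (simp add: mu_def)

lemma emeasure_mu: "A \<in> sets mu \<Longrightarrow> emeasure mu A = outer_mu A"
  using measure_space_outer_mu
  by (intro emeasure_measure_of[OF mu_def]) (auto simp: sets_mu measure_space_def)

lemma cylinder_in_sets_PiM:
  assumes "\<And>i. i < m \<Longrightarrow> C i \<in> sets borel"
  shows "{x :: nat \<Rightarrow> real. \<forall>i<m. x i \<in> C i} \<in> sets (\<Pi>\<^sub>M i\<in>UNIV. borel)"
proof -
  have "{x \<in> space (\<Pi>\<^sub>M i\<in>UNIV. borel). \<forall>i\<in>{..<m}. x i \<in> C i} \<in> sets (\<Pi>\<^sub>M i\<in>UNIV. borel :: real measure)"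
    using assms by (intro sets.sets_Collect_finite_All sets_Collect_single') auto
  then show ?thesis by (simp add: space_PiM Ball_def)
qed

lemma sets_mu_eq_PiM [measurable_cong]: "sets mu = sets (\<Pi>\<^sub>M i\<in>UNIV. borel)"
proof
  show "sets mu \<subseteq> sets (\<Pi>\<^sub>M i\<in>UNIV. borel)"
    unfolding sets_mu cylinders_def
    using cylinder_in_sets_PiM cylinder_in_sets_PiM[of 0]
    by (intro sets.sigma_sets_subset') auto
  have "{x. x i \<in> A} \<in> cylinders" if "A \<in> sets borel" for i A
    unfolding cylinders_def using that
    by (auto intro!: exI[of _ "Suc i"] exI[of _ "\<lambda>j. if j = i then A else UNIV"])
  then show "sets (\<Pi>\<^sub>M i\<in>UNIV. borel) \<subseteq> sets mu"
    unfolding sets_mu sets_PiM_single space_borel PiE_UNIV_domain Pi_UNIV by (intro sigma_sets_mono') auto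
qed

lemma cube_eq_rect: "cube a = rect (\<lambda>i. {of_int (a i) ..< of_int (a i) + 1})"
  by (auto simp: cube_def rect_def)

lemma finite_rect_cube:
  "finite_rect (\<lambda>i. {of_int (a i) ..< of_int (a i) + 1})"
  "rect_vol (\<lambda>i. {of_int (a i) ..< of_int (a i) + 1}) = 1"
  by (intro finite_rectI[where L=1]; simp)+

lemma rect_in_sets_PiM:
  assumes "\<And>i. C i \<in> sets borel"
  shows "rect C \<in> sets (\<Pi>\<^sub>M i\<in>UNIV. borel)"
proof -
  have "rect C = (\<Inter>m. {x. \<forall>i<m. x i \<in> C i})"
    by (auto simp: rect_def)
  then show ?thesis
    using assms by (auto intro!: cylinder_in_sets_PiM)
qed

lemma cube_in_sets_mu [measurable]: "cube a \<in> sets mu"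
  unfolding cube_eq_rect sets_mu_eq_PiM by (intro rect_in_sets_PiM) auto

text \<open>A probability measure that is dominated by the volume on cylinders and concentrated on a
  unit cube bounds \<open>\<mu>\<close> from below on the cube. Since both give the cube mass one, they agree.\<close>

lemma emeasure_mu_Int_cube:
  assumes N: "prob_space N" and sets: "sets N = sets (\<Pi>\<^sub>M i\<in>UNIV. borel)"
    and dom: "\<And>m C. (\<And>i. C i \<in> sets borel) \<Longrightarrow>
      emeasure N {x. \<forall>i<m. x i \<in> C i} \<le> (\<Prod>i<m. emeasure lborel (C i))"
    and conc: "AE x in N. x \<in> cube a"
    and A: "A \<in> sets mu"
  shows "emeasure mu (A \<inter> cube a) = emeasure N A"
proof -
  interpret prob_space N by fact
  have [measurable]: "cube a \<in> sets N"
    using cube_in_sets_mu[of a] by (simp add: sets sets_mu_eq_PiM)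
  have ge: "emeasure N B \<le> emeasure mu (B \<inter> cube a)" if B: "B \<in> sets mu" for B
  proof -
    have B' [measurable]: "B \<in> sets N" using B by (simp add: sets sets_mu_eq_PiM)
    have "emeasure N B = emeasure N (B \<inter> cube a)"
      using conc by (intro emeasure_eq_AE) auto
    also have "\<dots> \<le> outer_mu (B \<inter> cube a)"
    proof (rule outer_mu_greatest)
      fix C :: "nat \<Rightarrow> nat \<Rightarrow> real set"
      assume C: "\<And>n. finite_rect (C n)" "B \<inter> cube a \<subseteq> (\<Union>n. rect (C n))"
      have Cb: "C n i \<in> sets borel" for n i
        using C(1) by (auto simp: finite_rect_def)
      have Cs: "rect (C n) \<in> sets N" for n
        unfolding sets by (intro rect_in_sets_PiM Cb)
      have "emeasure N (rect (C n)) \<le> rect_vol (C n)" for n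
      proof (rule LIMSEQ_le_const[OF finite_rect_tendsto(1)[OF C(1)]], intro exI allI impI)
        fix m
        have "emeasure N (rect (C n)) \<le> emeasure N {x. \<forall>i<m. x i \<in> C n i}"
          using Cb by (intro emeasure_mono) (auto simp: rect_def sets intro!: cylinder_in_sets_PiM)
        also have "\<dots> \<le> (\<Prod>i<m. emeasure lborel (C n i))"
          by (intro dom Cb)
        finally show "emeasure N (rect (C n)) \<le> (\<Prod>i<m. emeasure lborel (C n i))" .
      qed
      then have "(\<Sum>n. emeasure N (rect (C n))) \<le> (\<Sum>n. rect_vol (C n))"
        by (intro suminf_le) auto
      moreover have "emeasure N (B \<inter> cube a) \<le> emeasure N (\<Union>n. rect (C n))"
        using C(2) Cs by (intro emeasure_mono) auto
      moreover have "\<dots> \<le> (\<Sum>n. emeasure N (rect (C n)))"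
        using Cs by (intro emeasure_subadditive_countably) auto
      ultimately show "emeasure N (B \<inter> cube a) \<le> (\<Sum>n. rect_vol (C n))"
        by order
    qed
    also have "\<dots> = emeasure mu (B \<inter> cube a)"
      using B by (subst emeasure_mu) auto
    finally show ?thesis .
  qed
  have Ac: "UNIV - A \<in> sets mu"
    using A by (metis sets.compl_sets space_mu)
  have "space N = UNIV"
    using sets_eq_imp_space_eq[OF sets] by (simp add: space_PiM)
  have "emeasure mu (A \<inter> cube a) + emeasure mu ((UNIV - A) \<inter> cube a) = emeasure mu (cube a)"
    using A Ac by (subst plus_emeasure) (auto intro!: arg_cong2[where f=emeasure])
  also have "\<dots> \<le> 1"
    using outer_mu_rect_le[OF finite_rect_cube(1)[of a]]
    by (simp add: emeasure_mu finite_rect_cube(2) cube_eq_rect[symmetric])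
  also have "1 = emeasure N A + emeasure N (UNIV - A)"
    using A Ac \<open>space N = UNIV\<close> emeasure_space_1
    by (subst plus_emeasure) (auto simp: sets sets_mu_eq_PiM)
  finally have le: "emeasure mu (A \<inter> cube a) + emeasure mu ((UNIV - A) \<inter> cube a)
      \<le> emeasure N A + emeasure N (UNIV - A)" .
  also have "\<dots> \<le> emeasure N A + emeasure mu ((UNIV - A) \<inter> cube a)"
    using ge[OF Ac] by (intro add_left_mono)
  finally have "emeasure mu (A \<inter> cube a) + emeasure mu ((UNIV - A) \<inter> cube a)
    \<le> emeasure N A + emeasure mu ((UNIV - A) \<inter> cube a)" .
  moreover have "emeasure mu ((UNIV - A) \<inter> cube a) \<noteq> top"
    using le by (metis emeasure_finite ennreal_add_eq_top neq_top_trans)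
  ultimately have "emeasure mu (A \<inter> cube a) \<le> emeasure N A"
    by (metis add.commute ennreal_add_left_cancel_le infinity_ennreal_def)
  with ge[OF A] show ?thesis by (rule antisym[rotated])
qed

section \<open>A measure preserving parametrization of the cubes\<close>

definition digits :: "real \<Rightarrow> nat \<Rightarrow> bool" where
  "digits t n = odd \<lfloor>2 ^ Suc n * t\<rfloor>"

definition bin_value :: "(nat \<Rightarrow> bool) \<Rightarrow> real" where
  "bin_value c = (\<Sum>n. of_bool (c n) * (1 / 2) ^ Suc n)"

abbreviation coin :: "bool measure" where
  "coin \<equiv> measure_pmf (bernoulli_pmf (1 / 2))"

definition coins :: "(nat \<Rightarrow> bool) measure" where
  "coins = (\<Pi>\<^sub>M n\<in>UNIV. coin)"

lemma digits_add_of_int: "digits (t + of_int k) = digits t"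
proof
  fix n
  have "2 ^ Suc n * (t + of_int k) = 2 ^ Suc n * t + of_int (2 ^ Suc n * k)"
    by (simp add: distrib_left)
  then have "\<lfloor>2 ^ Suc n * (t + of_int k)\<rfloor> = \<lfloor>2 ^ Suc n * t\<rfloor> + 2 ^ Suc n * k"
    by (metis floor_add_int)
  then show "digits (t + of_int k) n = digits t n"
    by (simp add: digits_def)
qed

lemma floor_double_div: "\<lfloor>2 ^ Suc m * t\<rfloor> div 2 = \<lfloor>2 ^ m * t :: real\<rfloor>"
  using floor_divide_real_eq_div[of 2 "2 ^ Suc m * t"] by simp

lemma floor_double: "\<lfloor>2 ^ Suc m * t\<rfloor> = 2 * \<lfloor>2 ^ m * t\<rfloor> + of_bool (digits t m)"
proof -
  have "\<lfloor>2 ^ Suc m * t\<rfloor> = 2 * (\<lfloor>2 ^ Suc m * t\<rfloor> div 2) + \<lfloor>2 ^ Suc m * t\<rfloor> mod 2"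
    by simp
  also have "\<lfloor>2 ^ Suc m * t\<rfloor> mod 2 = of_bool (digits t m)"
    by (simp add: digits_def mod_2_eq_odd)
  finally show ?thesis
    by (simp only: floor_double_div)
qed

lemma bin_value_digits:
  assumes t: "0 \<le> t" "t < 1"
  shows "bin_value (digits t) = t"
proof -
  have part: "(\<Sum>n<m. of_bool (digits t n) * (1 / 2 :: real) ^ Suc n) = of_int \<lfloor>2 ^ m * t\<rfloor> / 2 ^ m" for m
  proof (induction m)
    case 0
    then show ?case using t by (simp add: floor_unique[of 0])
  next
    case (Suc m)
    show ?case
      unfolding sum.lessThan_Suc Suc.IH floor_double
      by (simp add: field_simps power_one_over)
  qed
  have lim0: "(\<lambda>m. (1 / 2) ^ m :: real) \<longlonglongrightarrow> 0"
    by (rule LIMSEQ_realpow_zero) auto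
  have "(\<lambda>m. of_int \<lfloor>2 ^ m * t\<rfloor> / 2 ^ m) \<longlonglongrightarrow> t"
  proof (rule tendsto_sandwich[of "\<lambda>m. t - (1 / 2) ^ m" _ _ "\<lambda>_. t"])
    show "\<forall>\<^sub>F m in sequentially. t - (1 / 2) ^ m \<le> of_int \<lfloor>2 ^ m * t\<rfloor> / 2 ^ m"
    proof (intro always_eventually allI)
      fix m
      have "2 ^ m * t - 1 \<le> of_int \<lfloor>2 ^ m * t\<rfloor>" by linarith
      then have "(2 ^ m * t - 1) / 2 ^ m \<le> of_int \<lfloor>2 ^ m * t\<rfloor> / 2 ^ m"
        by (rule divide_right_mono) simp
      then show "t - (1 / 2) ^ m \<le> of_int \<lfloor>2 ^ m * t\<rfloor> / 2 ^ m"
        by (simp add: diff_divide_distrib power_one_over)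
    qed
    show "\<forall>\<^sub>F m in sequentially. of_int \<lfloor>2 ^ m * t\<rfloor> / 2 ^ m \<le> t"
    proof (intro always_eventually allI)
      fix m
      have "of_int \<lfloor>2 ^ m * t\<rfloor> \<le> 2 ^ m * t" by linarith
      then show "of_int \<lfloor>2 ^ m * t\<rfloor> / 2 ^ m \<le> t"
        by (simp add: field_simps)
    qed
    show "(\<lambda>m. t - (1 / 2) ^ m) \<longlonglongrightarrow> t"
      using tendsto_diff[OF tendsto_const lim0, of t] by simp
  qed auto
  then have "(\<lambda>n. of_bool (digits t n) * (1 / 2) ^ Suc n) sums t"
    unfolding sums_def part .
  then show ?thesis
    by (simp add: bin_value_def sums_iff)
qed

lemma dyadic_interval:
  "\<exists>N. \<forall>t. (0 \<le> t \<and> t < 1 \<and> (\<forall>n<m. digits t n = c n)) \<longleftrightarrow> \<lfloor>2 ^ m * t\<rfloor> = N"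
proof (induction m)
  case 0
  show ?case by (intro exI[of _ 0]) (auto simp: floor_eq_iff)
next
  case (Suc m)
  then obtain N where N: "\<And>t. (0 \<le> t \<and> t < 1 \<and> (\<forall>n<m. digits t n = c n)) \<longleftrightarrow> \<lfloor>2 ^ m * t\<rfloor> = N"
    by auto
  have "(0 \<le> t \<and> t < 1 \<and> (\<forall>n<Suc m. digits t n = c n))
      \<longleftrightarrow> \<lfloor>2 ^ Suc m * t\<rfloor> = 2 * N + of_bool (c m)" for t
  proof -
    have "(0 \<le> t \<and> t < 1 \<and> (\<forall>n<Suc m. digits t n = c n)) \<longleftrightarrow> \<lfloor>2 ^ m * t\<rfloor> = N \<and> digits t m = c m"
      using N[of t] by (auto simp: less_Suc_eq)
    also have "\<dots> \<longleftrightarrow> \<lfloor>2 ^ Suc m * t\<rfloor> = 2 * N + of_bool (c m)"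
      unfolding floor_double by (cases "digits t m"; cases "c m"; simp; presburger)
    finally show ?thesis .
  qed
  then show ?case by blast
qed

lemma emeasure_dyadic_interval:
  "emeasure lborel {t. 0 \<le> t \<and> t < 1 \<and> (\<forall>n<m. digits t n = c n)} = ennreal ((1 / 2) ^ m)"
proof -
  obtain N where N: "\<And>t. (0 \<le> t \<and> t < 1 \<and> (\<forall>n<m. digits t n = c n)) \<longleftrightarrow> \<lfloor>2 ^ m * t\<rfloor> = N"
    using dyadic_interval by blast
  have "{t. 0 \<le> t \<and> t < 1 \<and> (\<forall>n<m. digits t n = c n)} = {of_int N / 2 ^ m ..< (of_int N + 1) / 2 ^ m}"
    unfolding N by (auto simp: floor_eq_iff field_simps)
  then show ?thesis
    by (simp add: divide_right_mono diff_divide_distrib[symmetric] power_one_over)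
qed

lemma space_I01 [simp]: "space I01 = {0..1}"
  by (simp add: I01_def space_restrict_space)

lemma sets_I01 [measurable_cong]: "sets I01 = sets (restrict_space borel {0..1})"
  by (simp add: I01_def sets_restrict_space)

lemma emeasure_I01:
  assumes "A \<in> sets borel"
  shows "emeasure I01 (A \<inter> {0..1}) = emeasure lborel (A \<inter> {0..<1})"
proof -
  have "emeasure I01 (A \<inter> {0..1}) = emeasure lborel (A \<inter> {0..1})"
    unfolding I01_def by (intro emeasure_restrict_space) auto
  also have "\<dots> = emeasure lborel (A \<inter> {0..<1})"
    using assms
    by (intro emeasure_eq_AE eventually_mono[OF AE_lborel_singleton[of 1]]) auto
  finally show ?thesis .
qed

interpretation I01: prob_space I01
  by standard (use emeasure_I01[of UNIV] in simp)

lemma AE_I01: "AE t in I01. 0 \<le> t \<and> t < 1"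
  unfolding I01_def using AE_lborel_singleton[of 1] by (subst AE_restrict_space_iff) auto

lemma measurable_I01 [measurable]: "(\<lambda>x. x) \<in> borel_measurable I01"
  unfolding I01_def by (intro measurable_restrict_space1) simp

lemma coins_prod: "product_prob_space (\<lambda>_::nat. coin)"
  by unfold_locales

interpretation C: product_prob_space "\<lambda>_. coin" "UNIV :: nat set"
  by (rule coins_prod)

interpretation coins: prob_space coins
  unfolding coins_def by (rule C.P.prob_space_axioms)

lemma space_coins [simp]: "space coins = UNIV"
  by (simp add: coins_def space_PiM)

lemma sets_coins [measurable_cong]: "sets coins = sets (\<Pi>\<^sub>M n\<in>UNIV. count_space UNIV)"
  unfolding coins_def by (intro sets_PiM_cong) auto

lemma measurable_bin_value [measurable]: "bin_value \<in> borel_measurable coins"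
  unfolding bin_value_def by measurable

lemma measurable_digits_component [measurable]:
  "(\<lambda>t. digits t n) \<in> measurable borel (count_space UNIV)"
  unfolding digits_def by measurable

lemma measurable_coins_component [measurable]:
  "(\<lambda>c. c n) \<in> measurable coins (count_space UNIV)"
  by measurable

lemma measurable_coinsI:
  assumes "\<And>n. (\<lambda>x. f x n) \<in> measurable M (count_space UNIV)"
  shows "f \<in> measurable M coins"
proof -
  have "(\<lambda>x. \<lambda>n\<in>UNIV. f x n) \<in> measurable M (\<Pi>\<^sub>M n\<in>UNIV. count_space UNIV)"
    using assms by (intro measurable_restrict)
  then show ?thesis
    by (simp add: measurable_cong_sets[OF refl sets_coins] restrict_UNIV)
qed

lemma measurable_digits [measurable]: "digits \<in> measurable borel coins"
  by (intro measurable_coinsI measurable_digits_component)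

lemma emeasure_coin: "emeasure coin A = ennreal (card A / 2)"
proof -
  have "pmf (bernoulli_pmf (1 / 2)) b = 1 / 2" for b
    by (cases b) auto
  then show ?thesis
    by (simp add: emeasure_measure_pmf_finite)
qed

lemma emeasure_digits_in:
  "emeasure lborel {t. 0 \<le> t \<and> t < 1 \<and> (\<forall>n<m. digits t n \<in> F n)} = (\<Prod>n<m. emeasure coin (F n))"
proof -
  let ?E = "\<lambda>c. {t. 0 \<le> t \<and> t < 1 \<and> (\<forall>n<m. digits t n = c n)}"
  let ?I = "\<Pi>\<^sub>E n\<in>{..<m}. F n"
  have fin: "finite ?I"
    by (intro finite_PiE) auto
  have meas: "?E c \<in> sets lborel" for c
    by measurable
  have "{t. 0 \<le> t \<and> t < 1 \<and> (\<forall>n<m. digits t n \<in> F n)} = (\<Union>c\<in>?I. ?E c)"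
  proof safe
    fix t assume "0 \<le> t" "t < 1" "\<forall>n<m. digits t n \<in> F n"
    then show "t \<in> (\<Union>c\<in>?I. ?E c)"
      by (intro UN_I[of "restrict (digits t) {..<m}"]) auto
  qed (auto simp: PiE_iff)
  moreover have "disjoint_family_on ?E ?I"
  proof (unfold disjoint_family_on_def, intro ballI impI)
    fix c d assume cd: "c \<in> ?I" "d \<in> ?I" "c \<noteq> d"
    then obtain n where "n < m" "c n \<noteq> d n"
      using PiE_ext[OF cd(1,2)] by auto
    then show "?E c \<inter> ?E d = {}" by auto
  qed
  ultimately have "emeasure lborel {t. 0 \<le> t \<and> t < 1 \<and> (\<forall>n<m. digits t n \<in> F n)}
      = (\<Sum>c\<in>?I. emeasure lborel (?E c))"
    using fin meas by (simp add: sum_emeasure image_subset_iff)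
  also have "\<dots> = ennreal (card ?I * (1 / 2) ^ m)"
    by (simp add: emeasure_dyadic_interval ennreal_mult ennreal_of_nat_eq_real_of_nat)
  also have "real (card ?I) * (1 / 2) ^ m = (\<Prod>n<m. card (F n) / 2)"
    by (simp add: card_PiE prod_dividef power_one_over)
  also have "ennreal \<dots> = (\<Prod>n<m. emeasure coin (F n))"
    by (simp add: emeasure_coin prod_ennreal)
  finally show ?thesis .
qed

lemma distr_digits: "distr I01 coins digits = coins"
  unfolding coins_def
proof (rule C.PiM_eq)
  fix J :: "nat set" and F :: "nat \<Rightarrow> bool set"
  assume J: "finite J"
  define F' where "F' = (\<lambda>n. if n \<in> J then F n else UNIV)"
  obtain m where m: "J \<subseteq> {..<m}"
    using J finite_nat_iff_bounded by blast
  have emb: "prod_emb UNIV (\<lambda>_. coin) J (Pi\<^sub>E J F) = {c. \<forall>n<m. c n \<in> F' n}"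
    using m by (fastforce simp: prod_emb_def F'_def PiE_iff space_PiM)
  have [measurable]: "Measurable.pred borel (\<lambda>t. \<forall>n<m. digits t n \<in> F' n)"
    by measurable
  have "{c. \<forall>n<m. c n \<in> F' n} \<in> sets (Pi\<^sub>M UNIV (\<lambda>_. coin))"
    unfolding emb[symmetric] using J by (intro sets_PiM_I) auto
  then have "emeasure (distr I01 (Pi\<^sub>M UNIV (\<lambda>_. coin)) digits) (prod_emb UNIV (\<lambda>_. coin) J (Pi\<^sub>E J F))
      = emeasure I01 ({t. \<forall>n<m. digits t n \<in> F' n} \<inter> {0..1})"
    unfolding emb coins_def[symmetric]
    by (subst emeasure_distr) (auto intro!: arg_cong2[where f=emeasure])
  also have "\<dots> = emeasure lborel ({t. \<forall>n<m. digits t n \<in> F' n} \<inter> {0..<1})"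
    by (intro emeasure_I01) simp
  also have "{t. \<forall>n<m. digits t n \<in> F' n} \<inter> {0..<1} = {t. 0 \<le> t \<and> t < 1 \<and> (\<forall>n<m. digits t n \<in> F' n)}"
    by auto
  also have "emeasure lborel \<dots> = (\<Prod>n<m. emeasure coin (F' n))"
    by (rule emeasure_digits_in)
  also have "\<dots> = (\<Prod>n\<in>J. emeasure coin (F n))"
    using m by (intro prod.mono_neutral_cong_right) (auto simp: F'_def measure_pmf.emeasure_space_1[simplified])
  finally show "emeasure (distr I01 (Pi\<^sub>M UNIV (\<lambda>_. coin)) digits) (prod_emb UNIV (\<lambda>_. coin) J (Pi\<^sub>E J F))
      = (\<Prod>n\<in>J. emeasure coin (F n))" .
qed simp

definition digit_row :: "nat \<Rightarrow> (nat \<Rightarrow> 'a) \<Rightarrow> nat \<Rightarrow> 'a" where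
  "digit_row k c = (\<lambda>j. c (prod_encode (k, j)))"

lemma measurable_row [measurable]: "digit_row k \<in> measurable coins coins"
  unfolding digit_row_def by (intro measurable_coinsI measurable_coins_component)

lemma distr_row: "distr coins coins (digit_row k) = coins"
proof -
  have "distr (\<Pi>\<^sub>M n\<in>UNIV. coin) (\<Pi>\<^sub>M n\<in>UNIV. coin) (\<lambda>\<omega>. \<lambda>n\<in>UNIV. \<omega> (prod_encode (k, n))) = (\<Pi>\<^sub>M n\<in>UNIV. coin)"
    by (intro distr_PiM_reindex) (auto simp: inj_on_def measure_pmf.prob_space_axioms)
  then show ?thesis
    by (simp add: coins_def digit_row_def[abs_def] restrict_UNIV)
qed

lemma AE_row_digits:
  assumes "AE c in coins. P c"
  shows "AE t in I01. P (digit_row k (digits t))"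
proof -
  have "AE c in distr coins coins (digit_row k). P c"
    using assms unfolding distr_row .
  then have "AE c in distr I01 coins digits. P (digit_row k c)"
    unfolding distr_digits by (rule AE_distrD[rotated]) simp
  then show ?thesis
    by (rule AE_distrD[rotated]) measurable
qed

lemma AE_coins_bin_value: "AE c in coins. 0 \<le> bin_value c \<and> bin_value c < 1 \<and> digits (bin_value c) = c"
proof -
  have [measurable]: "(\<lambda>c. digits (bin_value c) n) \<in> measurable coins (count_space UNIV)" for n
    by measurable
  have "{c \<in> space coins. 0 \<le> bin_value c \<and> bin_value c < 1 \<and> (\<forall>n. digits (bin_value c) n = c n)} \<in> sets coins"
    by measurable
  then have "(AE c in distr I01 coins digits. 0 \<le> bin_value c \<and> bin_value c < 1 \<and> (\<forall>n. digits (bin_value c) n = c n)) \<longleftrightarrow>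
    (AE t in I01. 0 \<le> bin_value (digits t) \<and> bin_value (digits t) < 1 \<and> (\<forall>n. digits (bin_value (digits t)) n = digits t n))"
    by (intro AE_distr_iff) measurable
  moreover have "AE t in I01. 0 \<le> bin_value (digits t) \<and> bin_value (digits t) < 1 \<and> (\<forall>n. digits (bin_value (digits t)) n = digits t n)"
    using AE_I01 by eventually_elim (simp add: bin_value_digits)
  ultimately show ?thesis
    unfolding distr_digits fun_eq_iff by blast
qed

lemma distr_bin_value: "distr coins borel bin_value = distr I01 borel (\<lambda>t. t)"
proof -
  have "distr coins borel bin_value = distr (distr I01 coins digits) borel bin_value"
    by (simp add: distr_digits)
  also have "\<dots> = distr I01 borel (\<lambda>t. bin_value (digits t))"
    by (subst distr_distr) (auto simp: comp_def)
  also have "\<dots> = distr I01 borel (\<lambda>t. t)"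
    by (intro distr_cong_AE eventually_mono[OF AE_I01]) (auto simp: bin_value_digits)
  finally show ?thesis .
qed

lemma emeasure_bin_value_row_le:
  assumes A: "A \<in> sets borel"
  shows "emeasure coins {c. bin_value (digit_row k c) \<in> A} \<le> emeasure lborel A"
proof -
  have "emeasure coins {c. bin_value (digit_row k c) \<in> A} = emeasure (distr (distr coins coins (digit_row k)) borel bin_value) A"
  proof -
    have "emeasure (distr (distr coins coins (digit_row k)) borel bin_value) A
        = emeasure (distr coins borel (bin_value \<circ> digit_row k)) A"
      by (subst distr_distr) (rule measurable_bin_value measurable_row refl)+
    also have "\<dots> = emeasure coins ((bin_value \<circ> digit_row k) -` A \<inter> space coins)"
      using A by (intro emeasure_distr measurable_comp[OF measurable_row measurable_bin_value])
    finally show ?thesis by (simp add: vimage_def)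
  qed
  also have "\<dots> = emeasure I01 (A \<inter> {0..1})"
    unfolding distr_row distr_bin_value using A by (subst emeasure_distr) auto
  also have "\<dots> \<le> emeasure lborel A"
    unfolding emeasure_I01[OF A] using A by (intro emeasure_mono) auto
  finally show ?thesis .
qed

lemma indep_bin_value_row: "coins.indep_vars (\<lambda>_. borel) (\<lambda>k c. bin_value (digit_row k c)) UNIV"
proof -
  have "coins.indep_vars (\<lambda>_. coin) (\<lambda>n c. c n) UNIV"
  proof (subst coins.indep_vars_iff_distr_eq_PiM)
    show "distr coins (\<Pi>\<^sub>M n\<in>UNIV. coin) (\<lambda>c. \<lambda>n\<in>UNIV. c n) = (\<Pi>\<^sub>M n\<in>UNIV. distr coins coin (\<lambda>c. c n))"
    proof -
      have "distr coins coin (\<lambda>c. c n) = coin" for n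
        unfolding coins_def by (rule C.PiM_component) simp
      then show ?thesis
        by (simp only: restrict_UNIV) (simp add: coins_def)
    qed
  qed (auto simp: coins_def)
  then have "coins.indep_vars (\<lambda>k. \<Pi>\<^sub>M n\<in>range (\<lambda>j. prod_encode (k, j)). coin)
      (\<lambda>k c. restrict c (range (\<lambda>j. prod_encode (k, j)))) UNIV"
    by (rule coins.indep_vars_restrict) (auto simp: disjoint_family_on_def)
  then have "coins.indep_vars (\<lambda>_. borel)
      (\<lambda>k c. bin_value (digit_row k (restrict c (range (\<lambda>j. prod_encode (k, j)))))) UNIV"
  proof (rule coins.indep_vars_compose2)
    fix k :: nat
    let ?M = "\<Pi>\<^sub>M n\<in>range (\<lambda>j. prod_encode (k, j)). coin"
    have "(\<lambda>c. c (prod_encode (k, j))) \<in> measurable ?M coin" for j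
      by (intro measurable_component_singleton) auto
    then have "digit_row k \<in> measurable ?M coins"
      unfolding digit_row_def by (intro measurable_coinsI) (simp only: measurable_cong_sets[OF refl sets_measure_pmf_count_space])
    then show "(\<lambda>c. bin_value (digit_row k c)) \<in> borel_measurable ?M"
      by (rule measurable_compose[OF _ measurable_bin_value])
  qed
  then show ?thesis
    by (simp add: digit_row_def)
qed

definition cube_param :: "(nat \<Rightarrow> int) \<Rightarrow> real \<Rightarrow> nat \<Rightarrow> real" where
  "cube_param a t k = of_int (a k) + bin_value (digit_row k (digits t))"

text \<open>The digits of a real number do not depend on its integer part, hence one function inverts all
  the maps \<open>cube_param a\<close>.\<close>

definition cube_code :: "(nat \<Rightarrow> real) \<Rightarrow> real" where
  "cube_code x = bin_value (\<lambda>n. digits (x (fst (prod_decode n))) (snd (prod_decode n)))"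

lemma measurable_cube_param [measurable]: "cube_param a \<in> measurable borel (\<Pi>\<^sub>M k\<in>UNIV. borel)"
proof -
  have "(\<lambda>t. \<lambda>k\<in>UNIV. cube_param a t k) \<in> measurable borel (\<Pi>\<^sub>M k\<in>UNIV. borel)"
    unfolding cube_param_def by (intro measurable_restrict) measurable
  then show ?thesis by (simp add: restrict_UNIV)
qed

lemma measurable_cube_code [measurable]: "cube_code \<in> borel_measurable (\<Pi>\<^sub>M k\<in>UNIV. borel)"
proof -
  have "(\<lambda>x n. digits (x (fst (prod_decode n))) (snd (prod_decode n)))
      \<in> measurable (\<Pi>\<^sub>M k\<in>UNIV. borel) coins"
    by (intro measurable_coinsI) measurable
  then show ?thesis
    unfolding cube_code_def[abs_def] by measurable
qed

lemma AE_cube_param_in_cube: "AE t in I01. cube_param a t \<in> cube a"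
proof -
  have "AE t in I01. \<forall>k. 0 \<le> bin_value (digit_row k (digits t)) \<and> bin_value (digit_row k (digits t)) < 1"
    unfolding AE_all_countable
    using AE_coins_bin_value by (intro allI AE_row_digits) (auto elim: eventually_mono)
  then show ?thesis
    by eventually_elim (auto simp: cube_def cube_param_def)
qed

lemma AE_cube_code_param: "AE t in I01. cube_code (cube_param a t) = t"
proof -
  have "AE t in I01. \<forall>k. digits (bin_value (digit_row k (digits t))) = digit_row k (digits t)"
    unfolding AE_all_countable
    using AE_coins_bin_value by (intro allI AE_row_digits) (auto elim: eventually_mono)
  with AE_I01 show ?thesis
  proof eventually_elim
    case (elim t)
    have "digits (cube_param a t k) = digit_row k (digits t)" for k
      using elim digits_add_of_int[of "bin_value (digit_row k (digits t))" "a k"]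
      by (simp add: cube_param_def add.commute)
    then show ?case
      using elim by (simp add: cube_code_def digit_row_def bin_value_digits)
  qed
qed

lemma measurable_cube_param_I01 [measurable]: "cube_param a \<in> measurable I01 (\<Pi>\<^sub>M k\<in>UNIV. borel)"
  using measurable_compose[OF measurable_I01 measurable_cube_param] .

lemma emeasure_cube_param_le:
  assumes C: "\<And>i. C i \<in> sets borel"
  shows "emeasure (distr I01 (\<Pi>\<^sub>M k\<in>UNIV. borel) (cube_param a)) {x. \<forall>i<m. x i \<in> C i}
    \<le> (\<Prod>i<m. emeasure lborel (C i))"
proof (cases "m = 0")
  case True
  interpret prob_space "distr I01 (\<Pi>\<^sub>M k\<in>UNIV. borel) (cube_param a)"
    by (intro I01.prob_space_distr) simp
  show ?thesis using True by (simp add: emeasure_le_1)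
next
  case False
  define B where "B i = (\<lambda>s. of_int (a i) + s) -` C i" for i
  have B [measurable]: "B i \<in> sets borel" for i
    using measurable_sets[of "\<lambda>s. of_int (a i) + s" borel borel "C i"] C by (simp add: B_def)
  have Bvol: "emeasure lborel (B i) = emeasure lborel (C i)" for i
    using emeasure_distr[of "(+) (real_of_int (a i))" lborel borel "C i"] C
    by (simp add: lborel_distr_plus B_def)
  have "emeasure (distr I01 (\<Pi>\<^sub>M k\<in>UNIV. borel) (cube_param a)) {x. \<forall>i<m. x i \<in> C i}
      = emeasure I01 (digits -` {c. \<forall>i<m. bin_value (digit_row i c) \<in> B i} \<inter> space I01)"
    using C cylinder_in_sets_PiM[of m C]
    by (subst emeasure_distr) (auto intro!: arg_cong2[where f=emeasure] simp: cube_param_def B_def)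
  also have "\<dots> = emeasure (distr I01 coins digits) {c. \<forall>i<m. bin_value (digit_row i c) \<in> B i}"
  proof (rule emeasure_distr[symmetric])
    have "{c \<in> space coins. \<forall>i<m. bin_value (digit_row i c) \<in> B i} \<in> sets coins"
      by measurable
    then show "{c. \<forall>i<m. bin_value (digit_row i c) \<in> B i} \<in> sets coins"
      by simp
  qed measurable
  also have "\<dots> = emeasure coins (\<Inter>i\<in>{..<m}. (\<lambda>c. bin_value (digit_row i c)) -` B i \<inter> space coins)"
    unfolding distr_digits by (intro arg_cong2[where f=emeasure]) (use False in auto)
  also have "\<dots> = (\<Prod>i<m. emeasure coins {c. bin_value (digit_row i c) \<in> B i})"
    using False coins.indep_varsD[OF indep_bin_value_row, of "{..<m}" B] B
    by (simp add: lessThan_empty_iff coins.emeasure_eq_measure prod_ennreal vimage_def)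
  also have "\<dots> \<le> (\<Prod>i<m. emeasure lborel (C i))"
    using emeasure_bin_value_row_le[OF B] by (intro prod_mono_ennreal) (simp flip: Bvol)
  finally show ?thesis .
qed

lemma emeasure_mu_cube:
  assumes "A \<in> sets mu"
  shows "emeasure mu (A \<inter> cube a) = emeasure (distr I01 (\<Pi>\<^sub>M k\<in>UNIV. borel) (cube_param a)) A"
proof (rule emeasure_mu_Int_cube[OF _ _ emeasure_cube_param_le _ assms])
  show "AE x in distr I01 (\<Pi>\<^sub>M k\<in>UNIV. borel) (cube_param a). x \<in> cube a"
    using AE_cube_param_in_cube cube_in_sets_mu[of a]
    by (subst AE_distr_iff) (auto simp: space_PiM sets_mu_eq_PiM)
qed (auto intro: I01.prob_space_distr)

lemma nn_integral_cube:
  assumes f: "f \<in> borel_measurable mu"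
  shows "(\<integral>\<^sup>+ x. indicator (cube a) x * f x \<partial>mu) = (\<integral>\<^sup>+ t. f (cube_param a t) \<partial>I01)"
proof -
  let ?N = "distr I01 (\<Pi>\<^sub>M k\<in>UNIV. borel) (cube_param a)"
  have "density mu (indicator (cube a)) = ?N"
  proof (rule measure_eqI)
    fix A assume A: "A \<in> sets (density mu (indicator (cube a)))"
    then have "emeasure (density mu (indicator (cube a))) A = emeasure mu (A \<inter> cube a)"
      by (simp add: emeasure_density Int_commute flip: indicator_inter_arith)
    with A show "emeasure (density mu (indicator (cube a))) A = emeasure ?N A"
      by (simp add: emeasure_mu_cube)
  qed (simp add: sets_mu_eq_PiM)
  then have "(\<integral>\<^sup>+ x. f x \<partial>density mu (indicator (cube a))) = (\<integral>\<^sup>+ x. f x \<partial>?N)"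
    by simp
  then show ?thesis
    using f by (simp add: nn_integral_density nn_integral_distr)
qed

section \<open>The decomposition\<close>

lemma Lp_iff:
  "f \<in> Lp p M \<longleftrightarrow> f \<in> borel_measurable M \<and> (\<integral>\<^sup>+ x. ennreal (\<bar>f x\<bar> powr p) \<partial>M) < \<infinity>"
  unfolding Lp_def by (auto simp: integrable_iff_bounded)

lemma lpnorm_powr:
  assumes "f \<in> Lp p M" "1 \<le> p"
  shows "ennreal (lpnorm p M f powr p) = (\<integral>\<^sup>+ x. ennreal (\<bar>f x\<bar> powr p) \<partial>M)"
proof -
  have "lpnorm p M f powr p = (\<integral>x. \<bar>f x\<bar> powr p \<partial>M)"
    using assms(2) by (simp add: lpnorm_def powr_powr)
  with assms(1) show ?thesis
    by (simp add: Lp_def nn_integral_eq_integral)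
qed

lemma lpnorm_eq_enn2real:
  assumes "f \<in> Lp p M"
  shows "lpnorm p M f = enn2real (\<integral>\<^sup>+ x. ennreal (\<bar>f x\<bar> powr p) \<partial>M) powr (1 / p)"
  using assms by (simp add: Lp_def lpnorm_def nn_integral_eq_integral)

lemma lp_sum_norm_eq_0:
  assumes "\<And>i. AE x in I01. h i x = 0"
  shows "lp_sum_norm p h = 0"
proof -
  have "lpnorm p I01 (h i) = 0" for i
  proof -
    have "(\<integral>x. \<bar>h i x\<bar> powr p \<partial>I01) = 0"
      by (intro integral_eq_zero_AE eventually_mono[OF assms[of i]]) simp
    then show ?thesis by (simp add: lpnorm_def)
  qed
  then show ?thesis by (simp add: lp_sum_norm_def)
qed

lemma infsum_emeasure_UN:
  assumes I: "countable I" and X: "\<And>i. i \<in> I \<Longrightarrow> X i \<in> sets M" and disj: "disjoint_family_on X I"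
  shows "(\<Sum>\<^sub>\<infinity> i\<in>I. emeasure M (X i)) = emeasure M (\<Union>i\<in>I. X i)"
proof (cases "finite I")
  case True
  then show ?thesis
    using X disj by (simp add: sum_emeasure image_subset_iff)
next
  case False
  let ?e = "from_nat_into I"
  have bij: "bij_betw ?e UNIV I"
    using I False by (rule bij_betw_from_nat_into)
  then have eI: "\<And>n. ?e n \<in> I" and inj: "inj ?e" and surj: "range ?e = I"
    by (auto simp: bij_betw_def)
  have "(\<Sum>\<^sub>\<infinity> i\<in>I. emeasure M (X i)) = (\<Sum>\<^sub>\<infinity> n\<in>UNIV. emeasure M (X (?e n)))"
    using infsum_reindex_bij_betw[OF bij, of "\<lambda>i. emeasure M (X i)"] by simp
  also have "\<dots> = (\<Sum>n. emeasure M (X (?e n)))"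
    by (intro sums_unique has_sum_imp_sums has_sum_infsum nonneg_summable_on_complete) simp
  also have "\<dots> = emeasure M (\<Union>n. X (?e n))"
    using X eI disj inj
    by (intro suminf_emeasure) (auto simp: disjoint_family_on_def inj_eq simp del: Int_iff)
  also have "(\<Union>n. X (?e n)) = (\<Union>i\<in>I. X i)"
    using arg_cong[OF surj, of "\<lambda>A. \<Union>(X ` A)"] by (simp add: image_image)
  finally show ?thesis .
qed

lemma countable_support_infsum_ennreal:
  fixes f :: "'a \<Rightarrow> ennreal"
  assumes "(\<Sum>\<^sub>\<infinity> x\<in>A. f x) < \<infinity>"
  shows "countable {x\<in>A. f x \<noteq> 0}"
proof -
  let ?K = "\<Sum>\<^sub>\<infinity> x\<in>A. f x"
  have le: "sum f F \<le> ?K" if "finite F" "F \<subseteq> A" for F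
    using that by (subst nonneg_infsum_complete) (auto intro: SUP_upper)
  have fin: "f x < top" if "x \<in> A" for x
    using le[of "{x}"] that assms by auto
  have "(\<lambda>x. enn2real (f x)) summable_on A"
  proof (rule nonneg_bdd_above_summable_on)
    have "sum (\<lambda>x. enn2real (f x)) F \<le> enn2real ?K" if "F \<subseteq> A" "finite F" for F
    proof -
      have "sum (\<lambda>x. enn2real (f x)) F = enn2real (sum f F)"
        using that fin by (subst enn2real_sum) auto
      also have "\<dots> \<le> enn2real ?K"
        using le[OF that(2,1)] assms by (intro enn2real_mono) auto
      finally show ?thesis .
    qed
    then show "bdd_above (sum (\<lambda>x. enn2real (f x)) ` {F. F \<subseteq> A \<and> finite F})"
      by (intro bdd_aboveI2) auto
  qed simp
  then have "countable {x\<in>A. enn2real (f x) \<noteq> 0}"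
    by (rule summable_countable_real)
  then show ?thesis
    using fin by (rule_tac countable_subset) (auto simp: enn2real_eq_0_iff less_top)
qed

lemma mem_cube_iff: "x \<in> cube a \<longleftrightarrow> a = (\<lambda>n. \<lfloor>x n\<rfloor>)"
  by (auto simp: cube_def fun_eq_iff floor_eq_iff intro: sym)

lemma disjoint_cubes: "disjoint_family_on cube J"
  by (auto simp: disjoint_family_on_def mem_cube_iff)

abbreviation cube_int :: "real \<Rightarrow> ((nat \<Rightarrow> real) \<Rightarrow> real) \<Rightarrow> (nat \<Rightarrow> int) \<Rightarrow> ennreal" where
  "cube_int p f a \<equiv> \<integral>\<^sup>+ x. indicator (cube a) x * ennreal (\<bar>f x\<bar> powr p) \<partial>mu"

lemma sets_UN_cubes [measurable]: "countable J \<Longrightarrow> (\<Union>a\<in>J. cube a) \<in> sets mu"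
  by (intro sets.countable_UN'') auto

lemma infsum_cube_int:
  assumes J: "countable J" and f [measurable]: "f \<in> borel_measurable mu"
  shows "(\<Sum>\<^sub>\<infinity> a\<in>J. cube_int p f a)
    = (\<integral>\<^sup>+ x. indicator (\<Union>a\<in>J. cube a) x * ennreal (\<bar>f x\<bar> powr p) \<partial>mu)"
proof -
  let ?D = "density mu (\<lambda>x. ennreal (\<bar>f x\<bar> powr p))"
  have D: "emeasure ?D A = (\<integral>\<^sup>+ x. indicator A x * ennreal (\<bar>f x\<bar> powr p) \<partial>mu)" if "A \<in> sets mu" for A
    using that by (simp add: emeasure_density mult.commute)
  have "(\<Sum>\<^sub>\<infinity> a\<in>J. cube_int p f a) = (\<Sum>\<^sub>\<infinity> a\<in>J. emeasure ?D (cube a))"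
    by (simp add: D)
  also have "\<dots> = emeasure ?D (\<Union>a\<in>J. cube a)"
    by (intro infsum_emeasure_UN J disjoint_cubes) simp
  also have "\<dots> = (\<integral>\<^sup>+ x. indicator (\<Union>a\<in>J. cube a) x * ennreal (\<bar>f x\<bar> powr p) \<partial>mu)"
    by (intro D sets_UN_cubes J)
  finally show ?thesis .
qed

lemma infsum_all_cube_int_le:
  assumes f: "f \<in> borel_measurable mu"
  shows "(\<Sum>\<^sub>\<infinity> a\<in>UNIV. cube_int p f a) \<le> (\<integral>\<^sup>+ x. ennreal (\<bar>f x\<bar> powr p) \<partial>mu)"
proof (subst nonneg_infsum_complete, simp, intro SUP_least)
  fix F :: "(nat \<Rightarrow> int) set"
  assume F: "F \<in> {F. finite F \<and> F \<subseteq> UNIV}"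
  then have "(\<Sum>a\<in>F. cube_int p f a) = (\<Sum>\<^sub>\<infinity> a\<in>F. cube_int p f a)"
    by simp
  also have "\<dots> = (\<integral>\<^sup>+ x. indicator (\<Union>a\<in>F. cube a) x * ennreal (\<bar>f x\<bar> powr p) \<partial>mu)"
    using F f by (intro infsum_cube_int) (auto intro: countable_finite)
  also have "\<dots> \<le> (\<integral>\<^sup>+ x. ennreal (\<bar>f x\<bar> powr p) \<partial>mu)"
    by (intro nn_integral_mono) (auto simp: indicator_def)
  finally show "(\<Sum>a\<in>F. cube_int p f a) \<le> (\<integral>\<^sup>+ x. ennreal (\<bar>f x\<bar> powr p) \<partial>mu)" .
qed

lemma Ofun_iff: "a \<in> Ofun p f \<longleftrightarrow> cube_int p f a \<noteq> 0"
  by (simp add: Ofun_def)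

lemma countable_Ofun:
  assumes "f \<in> Lp p mu"
  shows "countable (Ofun p f)"
proof -
  have "(\<Sum>\<^sub>\<infinity> a\<in>UNIV. cube_int p f a) < \<infinity>"
    using assms infsum_all_cube_int_le[of f p] by (auto simp: Lp_iff)
  from countable_support_infsum_ennreal[OF this] show ?thesis
    by (simp add: Ofun_def)
qed

lemma sets_Ffun [measurable]: "f \<in> Lp p mu \<Longrightarrow> Ffun p f \<in> sets mu"
  unfolding Ffun_def by (intro sets_UN_cubes countable_Ofun)

lemma Gp_iff:
  assumes f: "f \<in> Lp p mu"
  shows "f \<in> Gp p \<longleftrightarrow> (AE x in mu. x \<notin> Ffun p f \<longrightarrow> f x = 0)"
proof -
  have [measurable]: "f \<in> borel_measurable mu" "Ffun p f \<in> sets mu"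
    using f by (auto simp: Lp_iff sets_Ffun)
  let ?g = "\<lambda>x. ennreal (\<bar>f x\<bar> powr p)"
  let ?F = "Ffun p f"
  have sum: "(\<Sum>\<^sub>\<infinity> a\<in>Ofun p f. cube_int p f a) = (\<integral>\<^sup>+ x. indicator ?F x * ?g x \<partial>mu)"
    unfolding Ffun_def by (intro infsum_cube_int countable_Ofun f) simp
  have split: "(\<integral>\<^sup>+ x. ?g x \<partial>mu)
      = (\<integral>\<^sup>+ x. indicator ?F x * ?g x \<partial>mu) + (\<integral>\<^sup>+ x. indicator (- ?F) x * ?g x \<partial>mu)"
    by (subst nn_integral_add[symmetric]) (auto intro!: nn_integral_cong simp: indicator_def)
  have fin: "(\<integral>\<^sup>+ x. indicator ?F x * ?g x \<partial>mu) \<noteq> top"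
    using f split by (auto simp: Lp_iff)
  have "f \<in> Gp p \<longleftrightarrow> (\<integral>\<^sup>+ x. ?g x \<partial>mu) = (\<integral>\<^sup>+ x. indicator ?F x * ?g x \<partial>mu)"
    using f by (simp add: Gp_def sum)
  also have "\<dots> \<longleftrightarrow> (\<integral>\<^sup>+ x. indicator (- ?F) x * ?g x \<partial>mu) = 0"
    unfolding split using fin ennreal_add_left_cancel[of _ _ 0] by auto
  also have "\<dots> \<longleftrightarrow> (AE x in mu. indicator (- ?F) x * ?g x = 0)"
    by (intro nn_integral_0_iff_AE) measurable
  also have "\<dots> \<longleftrightarrow> (AE x in mu. x \<notin> ?F \<longrightarrow> f x = 0)"
    by (intro AE_cong) (auto simp: indicator_def)
  finally show ?thesis .
qed

lemma Bp_iff: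
  assumes f: "f \<in> Lp p mu"
  shows "f \<in> Bp p \<longleftrightarrow> (\<forall>a. AE x in mu. x \<in> cube a \<longrightarrow> f x = 0)"
proof -
  have [measurable]: "f \<in> borel_measurable mu"
    using f by (auto simp: Lp_iff)
  have "cube_int p f a = 0 \<longleftrightarrow> (AE x in mu. x \<in> cube a \<longrightarrow> f x = 0)" for a
  proof -
    have "cube_int p f a = 0 \<longleftrightarrow> (AE x in mu. indicator (cube a) x * ennreal (\<bar>f x\<bar> powr p) = 0)"
      by (intro nn_integral_0_iff_AE) measurable
    also have "\<dots> \<longleftrightarrow> (AE x in mu. x \<in> cube a \<longrightarrow> f x = 0)"
      by (intro AE_cong) (auto simp: indicator_def)
    finally show ?thesis .
  qed
  then show ?thesis
    using f by (simp add: Bp_def)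
qed

lemma Lp_indicator_mult:
  assumes f: "f \<in> Lp p M" and A [measurable]: "A \<in> sets M"
  shows "(\<lambda>x. indicator A x * f x) \<in> Lp p M"
proof -
  have [measurable]: "f \<in> borel_measurable M"
    using f by (auto simp: Lp_iff)
  have "(\<integral>\<^sup>+ x. ennreal (\<bar>indicator A x * f x\<bar> powr p) \<partial>M) \<le> (\<integral>\<^sup>+ x. ennreal (\<bar>f x\<bar> powr p) \<partial>M)"
    by (intro nn_integral_mono) (auto simp: indicator_def)
  with f show ?thesis
    by (auto simp: Lp_iff)
qed

lemma Lp_decompose:
  assumes f: "f \<in> Lp p mu"
  shows "\<exists>g\<in>Gp p. \<exists>b\<in>Bp p. f = (\<lambda>x. g x + b x)"
proof -
  let ?g = "\<lambda>x. indicator (Ffun p f) x * f x" and ?b = "\<lambda>x. indicator (- Ffun p f) x * f x"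
  have F: "Ffun p f \<in> sets mu" "- Ffun p f \<in> sets mu"
    using sets_Ffun[OF f] sets.compl_sets[of "Ffun p f" mu] by (auto simp: Compl_eq_Diff_UNIV)
  have g: "?g \<in> Lp p mu" and b: "?b \<in> Lp p mu"
    using f F by (auto intro: Lp_indicator_mult)
  have in_F: "x \<in> Ffun p f \<longleftrightarrow> a \<in> Ofun p f" if "x \<in> cube a" for x a
    using that by (auto simp: Ffun_def mem_cube_iff)
  have "cube_int p ?g a = (if a \<in> Ofun p f then cube_int p f a else 0)" for a
    using in_F[of _ a]
    by (auto intro!: nn_integral_cong nn_integral_zero' AE_I2 simp: indicator_def)
  then have "Ofun p ?g = Ofun p f"
    by (auto simp: Ofun_iff)
  then have "Ffun p ?g = Ffun p f"
    by (simp add: Ffun_def)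
  then have "?g \<in> Gp p"
    by (subst Gp_iff[OF g]) auto
  moreover have "?b \<in> Bp p"
  proof -
    have "cube_int p ?b a = 0" for a
    proof (cases "a \<in> Ofun p f")
      case True
      then show ?thesis
        using in_F[of _ a] by (intro nn_integral_zero' AE_I2) (auto simp: indicator_def)
    next
      case False
      then have "cube_int p ?b a \<le> cube_int p f a"
        by (intro nn_integral_mono) (auto simp: indicator_def)
      with False show ?thesis by (simp add: Ofun_iff)
    qed
    then show ?thesis using b by (simp add: Bp_def)
  qed
  moreover have "f = (\<lambda>x. ?g x + ?b x)"
    by (auto simp: indicator_def)
  ultimately show ?thesis
    by (intro bexI[of _ ?g] bexI[of _ ?b])
qed

lemma Gp_Int_Bp:
  assumes "f \<in> Gp p" "f \<in> Bp p"
  shows "AE x in mu. f x = 0"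
proof -
  have "f \<in> Lp p mu" "Ofun p f = {}"
    using assms by (auto simp: Bp_def Ofun_def)
  with assms(1) show ?thesis
    by (simp add: Gp_iff Ffun_def)
qed

lemma lpnorm_Gp_le:
  assumes p: "1 \<le> p" and g: "g \<in> Gp p" and b: "b \<in> Bp p"
  shows "lpnorm p mu g \<le> lpnorm p mu (\<lambda>x. g x + b x)"
proof -
  have gL: "g \<in> Lp p mu" and bL: "b \<in> Lp p mu"
    using g b by (auto simp: Gp_def Bp_def)
  have [measurable]: "g \<in> borel_measurable mu" "b \<in> borel_measurable mu"
    using gL bL by (auto simp: Lp_def)
  have "AE x in mu. \<forall>a\<in>Ofun p g. x \<in> cube a \<longrightarrow> b x = 0"
    using b unfolding Bp_iff[OF bL] AE_ball_countable[OF countable_Ofun[OF gL]] by auto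
  with g[unfolded Gp_iff[OF gL]] have disj: "AE x in mu. g x = 0 \<or> b x = 0"
    by eventually_elim (auto simp: Ffun_def)
  have int: "integrable mu (\<lambda>x. \<bar>g x + b x\<bar> powr p)"
  proof (rule Bochner_Integration.integrable_bound)
    show "integrable mu (\<lambda>x. \<bar>g x\<bar> powr p + \<bar>b x\<bar> powr p)"
      using gL bL by (auto simp: Lp_def)
    show "AE x in mu. norm (\<bar>g x + b x\<bar> powr p) \<le> norm (\<bar>g x\<bar> powr p + \<bar>b x\<bar> powr p)"
      using disj by eventually_elim auto
  qed measurable
  have "(\<integral>x. \<bar>g x\<bar> powr p \<partial>mu) \<le> (\<integral>x. \<bar>g x + b x\<bar> powr p \<partial>mu)"
  proof (rule integral_mono_AE)
    show "AE x in mu. \<bar>g x\<bar> powr p \<le> \<bar>g x + b x\<bar> powr p"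
      using disj by eventually_elim auto
  qed (use gL int in \<open>auto simp: Lp_def\<close>)
  then show ?thesis
    unfolding lpnorm_def using p by (intro powr_mono2) auto
qed

lemma cube_int_eq_I01:
  assumes [measurable]: "f \<in> borel_measurable mu"
  shows "cube_int p f a = (\<integral>\<^sup>+ t. ennreal (\<bar>f (cube_param a t)\<bar> powr p) \<partial>I01)"
  by (intro nn_integral_cube) measurable

lemma Lp_cube_param:
  assumes f: "f \<in> Lp p mu"
  shows "(\<lambda>t. f (cube_param a t)) \<in> Lp p I01"
proof -
  have fm [measurable]: "f \<in> borel_measurable mu"
    using f by (auto simp: Lp_def)
  have "cube_int p f a \<le> (\<integral>\<^sup>+ x. ennreal (\<bar>f x\<bar> powr p) \<partial>mu)"
    by (intro nn_integral_mono) (auto simp: indicator_def)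
  with f show ?thesis
    by (auto simp: Lp_iff cube_int_eq_I01)
qed

lemma ex_bij_real_int_seq: "\<exists>\<phi> :: real \<Rightarrow> nat \<Rightarrow> int. bij \<phi>"
proof -
  have "inj (\<lambda>f :: nat \<Rightarrow> int. range (\<lambda>n. prod_encode (n, int_encode (f n))))"
  proof (intro injI ext)
    fix f g :: "nat \<Rightarrow> int" and n
    assume "range (\<lambda>n. prod_encode (n, int_encode (f n))) = range (\<lambda>n. prod_encode (n, int_encode (g n)))"
    then have "prod_encode (n, int_encode (f n)) \<in> range (\<lambda>n. prod_encode (n, int_encode (g n)))"
      by blast
    then show "f n = g n" by (auto simp: int_encode_eq)
  qed
  then have "(UNIV :: (nat \<Rightarrow> int) set) \<lesssim> (UNIV :: nat set set)"
    unfolding lepoll_def by auto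
  moreover have "(UNIV :: nat set set) \<lesssim> (UNIV :: (nat \<Rightarrow> int) set)"
    unfolding lepoll_def
    by (intro exI[of _ "\<lambda>A n. of_bool (n \<in> A)"]) (auto simp: inj_on_def fun_eq_iff)
  ultimately have "(UNIV :: real set) \<approx> (UNIV :: (nat \<Rightarrow> int) set)"
    by (meson lepoll_antisym eqpoll_sym eqpoll_trans nat_sets_eqpoll_reals)
  then show ?thesis
    by (auto simp: eqpoll_def)
qed

lemma Gp_infsum_cube_int:
  assumes "f \<in> Gp p"
  shows "(\<Sum>\<^sub>\<infinity> a\<in>UNIV. cube_int p f a) = (\<integral>\<^sup>+ x. ennreal (\<bar>f x\<bar> powr p) \<partial>mu)"
proof -
  have "(\<Sum>\<^sub>\<infinity> a\<in>UNIV. cube_int p f a) = (\<Sum>\<^sub>\<infinity> a\<in>Ofun p f. cube_int p f a)"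
    by (intro infsum_cong_neutral) (auto simp: Ofun_iff)
  then show ?thesis
    using assms by (simp add: Gp_def)
qed

lemma infsum_lpnorm_cube_param:
  assumes p: "1 \<le> p" and \<phi>: "bij \<phi>" and f: "f \<in> Gp p"
  shows "(\<Sum>\<^sub>\<infinity> i\<in>UNIV. ennreal (lpnorm p I01 (\<lambda>t. f (cube_param (\<phi> i) t)) powr p))
    = (\<integral>\<^sup>+ x. ennreal (\<bar>f x\<bar> powr p) \<partial>mu)"
proof -
  have fL: "f \<in> Lp p mu" and fm: "f \<in> borel_measurable mu"
    using f by (auto simp: Gp_def Lp_def)
  have "ennreal (lpnorm p I01 (\<lambda>t. f (cube_param (\<phi> i) t)) powr p) = cube_int p f (\<phi> i)" for i
    using lpnorm_powr[OF Lp_cube_param[OF fL] p] fm by (simp add: cube_int_eq_I01)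
  then have "(\<Sum>\<^sub>\<infinity> i\<in>UNIV. ennreal (lpnorm p I01 (\<lambda>t. f (cube_param (\<phi> i) t)) powr p))
      = (\<Sum>\<^sub>\<infinity> a\<in>UNIV. cube_int p f a)"
    using infsum_reindex_bij_betw[OF \<phi>, of "cube_int p f"] by simp
  then show ?thesis
    by (simp add: Gp_infsum_cube_int[OF f])
qed

lemma lp_sum_surj:
  assumes p: "1 \<le> p" and \<phi>: "bij \<phi>" and h: "h \<in> lp_sum p"
  obtains f where "f \<in> Gp p" "\<And>i. AE t in I01. f (cube_param (\<phi> i) t) = h i t"
proof -
  have hL: "\<And>i. h i \<in> Lp p I01"
    and hfin: "(\<Sum>\<^sub>\<infinity> i\<in>UNIV. ennreal (lpnorm p I01 (h i) powr p)) < \<infinity>"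
    using h by (auto simp: lp_sum_def)
  define N where "N = {i. lpnorm p I01 (h i) \<noteq> 0}"
  have "countable {i\<in>UNIV. ennreal (lpnorm p I01 (h i) powr p) \<noteq> 0}"
    by (rule countable_support_infsum_ennreal[OF hfin])
  moreover have "{i\<in>UNIV. ennreal (lpnorm p I01 (h i) powr p) \<noteq> 0} = N"
    by (auto simp: N_def lpnorm_def)
  ultimately have cN: "countable N" by simp
  have h0: "AE t in I01. h i t = 0" if "i \<notin> N" for i
  proof -
    have [measurable]: "h i \<in> borel_measurable I01"
      using hL by (auto simp: Lp_def)
    have "(\<integral>\<^sup>+ t. ennreal (\<bar>h i t\<bar> powr p) \<partial>I01) = 0"
      using that lpnorm_powr[OF hL p, of i] by (simp add: N_def)
    then show ?thesis
      by (subst (asm) nn_integral_0_iff_AE) auto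
  qed
  define k where "k i t = h i t * indicator {0..1} t" for i t
  have k [measurable]: "k i \<in> borel_measurable borel" for i
  proof -
    have "h i \<in> borel_measurable (restrict_space lborel {0..1})"
      using hL by (auto simp: Lp_def I01_def)
    then show ?thesis
      unfolding k_def by (subst (asm) borel_measurable_restrict_space_iff) (auto simp: mult.commute)
  qed
  define f where "f x = (let i = inv \<phi> (\<lambda>n. \<lfloor>x n\<rfloor>) in if i \<in> N then k i (cube_code x) else 0)" for x
  have f_cube: "f x = (if i \<in> N then k i (cube_code x) else 0)" if "x \<in> cube (\<phi> i)" for x i
  proof -
    have "inv \<phi> (\<lambda>n. \<lfloor>x n\<rfloor>) = i"
      using that inv_f_f[OF bij_is_inj[OF \<phi>], of i] by (simp add: mem_cube_iff)
    then show ?thesis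
      by (simp add: f_def)
  qed
  define F where "F = (\<Union>a\<in>\<phi> ` N. cube a)"
  have F: "F \<in> sets mu"
    unfolding F_def using cN by (intro sets_UN_cubes) simp
  have f_out: "f x = 0" if "x \<notin> F" for x
  proof -
    have "x \<in> cube (\<phi> (inv \<phi> (\<lambda>n. \<lfloor>x n\<rfloor>)))"
      using \<phi> by (simp add: mem_cube_iff bij_is_surj surj_f_inv_f)
    then show ?thesis
      using that by (auto simp: F_def f_cube)
  qed
  have fm [measurable]: "f \<in> borel_measurable mu"
  proof (rule measurable_piecewise_restrict[of "insert (- F) ((\<lambda>i. cube (\<phi> i)) ` N)"])
    show "\<Omega> \<inter> space mu \<in> sets mu" if "\<Omega> \<in> insert (- F) ((\<lambda>i. cube (\<phi> i)) ` N)" for \<Omega>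
      using that F sets.compl_sets[OF F] by (auto simp: Compl_eq_Diff_UNIV)
    show "f \<in> borel_measurable (restrict_space mu \<Omega>)"
      if "\<Omega> \<in> insert (- F) ((\<lambda>i. cube (\<phi> i)) ` N)" for \<Omega>
      using that
    proof
      assume "\<Omega> = - F"
      then show ?thesis
        using f_out by (subst measurable_cong[where g = "\<lambda>_. 0"]) (auto simp: space_restrict_space)
    next
      assume "\<Omega> \<in> (\<lambda>i. cube (\<phi> i)) ` N"
      then obtain i where i: "i \<in> N" "\<Omega> = cube (\<phi> i)" by auto
      have "(\<lambda>x. k i (cube_code x)) \<in> borel_measurable mu"
        by measurable
      then have "(\<lambda>x. k i (cube_code x)) \<in> borel_measurable (restrict_space mu \<Omega>)"
        by (rule measurable_restrict_space1)
      then show ?thesis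
        using i f_cube by (subst measurable_cong[where g = "\<lambda>x. k i (cube_code x)"])
          (auto simp: space_restrict_space)
    qed
  qed (use cN in \<open>auto simp: F_def\<close>)
  have f_param: "AE t in I01. f (cube_param (\<phi> i) t) = h i t" for i
  proof (cases "i \<in> N")
    case True
    show ?thesis
      using AE_cube_param_in_cube[of "\<phi> i"] AE_cube_code_param[of "\<phi> i"] AE_I01
      by eventually_elim (use True in \<open>simp add: f_cube k_def\<close>)
  next
    case False
    show ?thesis
      using AE_cube_param_in_cube[of "\<phi> i"] h0[OF False]
      by eventually_elim (use False in \<open>simp add: f_cube\<close>)
  qed
  have f_int: "cube_int p f (\<phi> i) = ennreal (lpnorm p I01 (h i) powr p)" for i
  proof -
    have "cube_int p f (\<phi> i) = (\<integral>\<^sup>+ t. ennreal (\<bar>f (cube_param (\<phi> i) t)\<bar> powr p) \<partial>I01)"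
      by (rule cube_int_eq_I01) simp
    also have "\<dots> = (\<integral>\<^sup>+ t. ennreal (\<bar>h i t\<bar> powr p) \<partial>I01)"
      by (intro nn_integral_cong_AE eventually_mono[OF f_param[of i]]) simp
    finally show ?thesis
      by (simp add: lpnorm_powr[OF hL p])
  qed
  have "a \<in> Ofun p f \<longleftrightarrow> a \<in> \<phi> ` N" for a
  proof -
    obtain i where i: "a = \<phi> i"
      using \<phi> by (metis bij_pointE)
    then have "a \<in> \<phi> ` N \<longleftrightarrow> i \<in> N"
      using \<phi> by (simp add: bij_is_inj inj_image_mem_iff)
    then show ?thesis
      by (simp add: Ofun_iff i f_int) (auto simp: N_def lpnorm_def)
  qed
  then have "Ofun p f = \<phi> ` N"
    by auto
  then have Ff: "Ffun p f = F"
    by (simp add: Ffun_def F_def)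
  have "(\<integral>\<^sup>+ x. ennreal (\<bar>f x\<bar> powr p) \<partial>mu) = (\<integral>\<^sup>+ x. indicator F x * ennreal (\<bar>f x\<bar> powr p) \<partial>mu)"
    using f_out by (intro nn_integral_cong) (auto simp: indicator_def)
  also have "\<dots> = (\<Sum>\<^sub>\<infinity> a\<in>\<phi> ` N. cube_int p f a)"
    unfolding F_def using cN by (subst infsum_cube_int) auto
  also have "\<dots> = (\<Sum>\<^sub>\<infinity> i\<in>N. ennreal (lpnorm p I01 (h i) powr p))"
    using \<phi> by (subst infsum_reindex) (auto simp: bij_def inj_on_def f_int comp_def)
  also have "\<dots> = (\<Sum>\<^sub>\<infinity> i\<in>UNIV. ennreal (lpnorm p I01 (h i) powr p))"
    by (intro infsum_cong_neutral) (auto simp: N_def)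
  also note hfin
  finally have fL: "f \<in> Lp p mu"
    by (simp add: Lp_iff)
  have "f \<in> Gp p"
    unfolding Gp_iff[OF fL] Ff using f_out by simp
  with f_param that show thesis by blast
qed

theorem theorem3p7:
  fixes p :: real
  assumes "1 \<le> p"
  shows
    \<comment> \<open>L^p = G^p + B^p\<close>
    "(\<forall>f\<in>Lp p mu. \<exists>g\<in>Gp p. \<exists>b\<in>Bp p. f = (\<lambda>x. g x + b x))
     \<comment> \<open>G^p \<inter> B^p = {0} in L^p\<close>
   \<and> (\<forall>f\<in>Gp p \<inter> Bp p. AE x in mu. f x = 0)
     \<comment> \<open>the decomposition is topological (complemented subspaces)\<close>
   \<and> (\<exists>C. \<forall>g\<in>Gp p. \<forall>b\<in>Bp p. lpnorm p mu g \<le> C * lpnorm p mu (\<lambda>x. g x + b x))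
     \<comment> \<open>G^p is isomorphic to l^p(c, L^p[0,1])\<close>
   \<and> (\<exists>T :: ((nat \<Rightarrow> real) \<Rightarrow> real) \<Rightarrow> real \<Rightarrow> real \<Rightarrow> real.
        (\<forall>f\<in>Gp p. T f \<in> lp_sum p)
      \<and> (\<forall>f\<in>Gp p. \<forall>g\<in>Gp p. \<forall>a b :: real.
           lp_sum_norm p (\<lambda>i x. T (\<lambda>y. a * f y + b * g y) i x - (a * T f i x + b * T g i x)) = 0)
      \<and> (\<exists>c1 > 0. \<exists>c2. \<forall>f\<in>Gp p.
           c1 * lpnorm p mu f \<le> lp_sum_norm p (T f) \<and> lp_sum_norm p (T f) \<le> c2 * lpnorm p mu f)
      \<and> (\<forall>h\<in>lp_sum p. \<exists>f\<in>Gp p. lp_sum_norm p (\<lambda>i x. T f i x - h i x) = 0))"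
proof (intro conjI)
  show "\<forall>f\<in>Lp p mu. \<exists>g\<in>Gp p. \<exists>b\<in>Bp p. f = (\<lambda>x. g x + b x)"
    by (intro ballI Lp_decompose)
  show "\<forall>f\<in>Gp p \<inter> Bp p. AE x in mu. f x = 0"
    using Gp_Int_Bp by auto
  show "\<exists>C. \<forall>g\<in>Gp p. \<forall>b\<in>Bp p. lpnorm p mu g \<le> C * lpnorm p mu (\<lambda>x. g x + b x)"
    using lpnorm_Gp_le[OF assms] by (intro exI[of _ 1]) simp
next
  obtain \<phi> :: "real \<Rightarrow> nat \<Rightarrow> int" where \<phi>: "bij \<phi>"
    using ex_bij_real_int_seq by blast
  define T :: "((nat \<Rightarrow> real) \<Rightarrow> real) \<Rightarrow> real \<Rightarrow> real \<Rightarrow> real"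
    where "T f i t = f (cube_param (\<phi> i) t)" for f i t
  note sum_T = infsum_lpnorm_cube_param[OF assms \<phi>, folded T_def]
  have T_Lp: "T f i \<in> Lp p I01" if "f \<in> Gp p" for f i
    using Lp_cube_param[of f p "\<phi> i"] that unfolding T_def[abs_def] Gp_def by simp
  have "T f \<in> lp_sum p" if f: "f \<in> Gp p" for f
  proof -
    have "f \<in> Lp p mu"
      using f by (simp add: Gp_def)
    then show ?thesis
      using sum_T[OF f] T_Lp[OF f] by (simp add: lp_sum_def Lp_iff)
  qed
  moreover have "lp_sum_norm p (\<lambda>i x. T (\<lambda>y. a * f y + b * g y) i x - (a * T f i x + b * T g i x)) = 0"
    for f g a b
    by (intro lp_sum_norm_eq_0) (simp add: T_def)
  moreover have "lp_sum_norm p (T f) = lpnorm p mu f" if f: "f \<in> Gp p" for f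
    using sum_T[OF f] f by (simp add: lp_sum_norm_def lpnorm_eq_enn2real Gp_def)
  moreover have "\<exists>f\<in>Gp p. lp_sum_norm p (\<lambda>i x. T f i x - h i x) = 0" if h: "h \<in> lp_sum p" for h
  proof -
    obtain f where f: "f \<in> Gp p" "\<And>i. AE t in I01. T f i t = h i t"
      using lp_sum_surj[OF assms \<phi> h] unfolding T_def by blast
    have "lp_sum_norm p (\<lambda>i x. T f i x - h i x) = 0"
      by (intro lp_sum_norm_eq_0 eventually_mono[OF f(2)]) simp
    with f(1) show ?thesis by blast
  qed
  ultimately show "\<exists>T :: ((nat \<Rightarrow> real) \<Rightarrow> real) \<Rightarrow> real \<Rightarrow> real \<Rightarrow> real.
        (\<forall>f\<in>Gp p. T f \<in> lp_sum p)
      \<and> (\<forall>f\<in>Gp p. \<forall>g\<in>Gp p. \<forall>a b :: real.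
           lp_sum_norm p (\<lambda>i x. T (\<lambda>y. a * f y + b * g y) i x - (a * T f i x + b * T g i x)) = 0)
      \<and> (\<exists>c1 > 0. \<exists>c2. \<forall>f\<in>Gp p.
           c1 * lpnorm p mu f \<le> lp_sum_norm p (T f) \<and> lp_sum_norm p (T f) \<le> c2 * lpnorm p mu f)
      \<and> (\<forall>h\<in>lp_sum p. \<exists>f\<in>Gp p. lp_sum_norm p (\<lambda>i x. T f i x - h i x) = 0)"
    by (intro exI[of _ T] conjI exI[of _ "1::real"]) simp_all
qed

end
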